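(* Let $d\ge1$ be an integer and let $\Omega\subseteq\mathbb{R}^d$ be a locally compact set. For a typical continuous function $f\colon\Omega\to\mathbb{R}$ there is a set $A\subseteq\Omega$ such that (i) $A$ is $\sigma$-strongly porous in $\mathbb{R}^d$ and the lower packing dimension of $A$ satisfies $\underline{\dim}_{\mathsf P}A\le d-1$; (ii) $f^{-1}(y)\subseteq A$ for all $y\in\mathbb{R}$ except for a set of $y$ of Hausdorff dimension zero.
   Context: $C(\Omega)$, the space of continuous real functions on $\Omega$, carries the compact-open topology. "For a typical $f$ ... holds" means: there is a comeager set $\mathcal{F}\subseteq C(\Omega)$ such that every $f\in\mathcal{F}$ has the property. $B(x,r)$ denotes a closed ball. Strong porosity: for a subset $E$ of a metric space $X$, $x\in E$, $r>0$, let $\gamma(E,x,r)=\sup\{s:\exists y\in B(x,r)\ B(y,s)\cap E=\emptyset\}$ (with $\sup\emptyset=0$; balls in $X$) and $\mathsf{por}(E,x)=\limsup_{r\to0}\gamma(E,x,r)/r$. $E$ is strongly porous if $\mathsf{por}(E,x)=1$ for every $x\in E$; $E$ is $\sigma$-strongly porous if it is a countable union of strongly porous sets. Lower packing dimension: for $\delta>0$ let $N_\delta(E)$ be the least number of sets of diameter at most $\delta$ needed to cover $E$. For $s>0$ let $\boldsymbol{\nu}^s_0(E)=\liminf_{\delta\to0}N_\delta(E)\delta^s$ and $\boldsymbol{\nu}^s(E)=\inf\{\sum_n\boldsymbol{\nu}^s_0(E_n):\{E_n\}\text{ a countable cover of }E\}$. Then $\underline{\dim}_{\mathsf P}E=\sup\{s>0:\boldsymbol{\nu}^s(E)>0\}$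 ($\sup\emptyset=0$). Hausdorff dimension is the usual one (the empty set has dimension $0$). *)

theory Defs
  imports "HOL-Analysis.Analysis"
begin

section \<open>The function space and typical functions\<close>

text \<open>As in \<^const>\<open>cfunspace\<close>, functions on \<open>S\<close> are represented by extensional functions,
  so that two functions that agree on \<open>S\<close> are equal.\<close>

definition continuous_functions :: "'a::topological_space set \<Rightarrow> ('a \<Rightarrow> real) set" where
  "continuous_functions S = {f \<in> extensional S. continuous_on S f}"

definition compact_open_topology :: "'a::topological_space set \<Rightarrow> ('a \<Rightarrow> real) topology" where
  "compact_open_topology S = topology_generated_by
     {{f \<in> continuous_functions S. f ` K \<subseteq> U} |K U. compact K \<and> K \<subseteq> S \<and> open U}"

lemma topspace_compact_open_topology [simp]:
  "topspace (compact_open_topology S) = continuous_functions S"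
proof
  show "continuous_functions S \<subseteq> topspace (compact_open_topology S)"
    unfolding compact_open_topology_def topology_generated_by_topspace
    by (rule Union_upper, simp, rule exI [of _ "{}"], rule exI [of _ UNIV]) auto
qed (auto simp: compact_open_topology_def)

definition nowhere_dense_in :: "'a topology \<Rightarrow> 'a set \<Rightarrow> bool" where
  "nowhere_dense_in X S \<longleftrightarrow> S \<subseteq> topspace X \<and> X interior_of (X closure_of S) = {}"

definition meager_in :: "'a topology \<Rightarrow> 'a set \<Rightarrow> bool" where
  "meager_in X S \<longleftrightarrow> (\<exists>M :: nat \<Rightarrow> 'a set. (\<forall>n. nowhere_dense_in X (M n)) \<and> S = (\<Union>n. M n))"

definition comeager_in :: "'a topology \<Rightarrow> 'a set \<Rightarrow> bool" where
  "comeager_in X S \<longleftrightarrow> S \<subseteq> topspace X \<and> meager_in X (topspace X - S)"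


section \<open>Porosity\<close>

text \<open>In \<^typ>\<open>ennreal\<close> the supremum of the empty set is \<open>0\<close>.  The condition \<open>0 < s\<close> is needed
  because \<^term>\<open>cball y s\<close> is empty for \<open>s < 0\<close>.\<close>

definition pore_size :: "'a::metric_space set \<Rightarrow> 'a \<Rightarrow> real \<Rightarrow> ennreal" where
  "pore_size E x r = Sup {ennreal s |s. 0 < s \<and> (\<exists>y \<in> cball x r. cball y s \<inter> E = {})}"

definition porosity :: "'a::metric_space set \<Rightarrow> 'a \<Rightarrow> ennreal" where
  "porosity E x = Limsup (at_right 0) (\<lambda>r. pore_size E x r / ennreal r)"

definition strongly_porous :: "'a::metric_space set \<Rightarrow> bool" where
  "strongly_porous E \<longleftrightarrow> (\<forall>x \<in> E. porosity E x = 1)"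

definition sigma_strongly_porous :: "'a::metric_space set \<Rightarrow> bool" where
  "sigma_strongly_porous E \<longleftrightarrow>
     (\<exists>P :: nat \<Rightarrow> 'a set. (\<forall>n. strongly_porous (P n)) \<and> E = (\<Union>n. P n))"


section \<open>Lower packing dimension\<close>

text \<open>Here and below, boundedness is required explicitly because \<^const>\<open>diameter\<close> is not
  meaningful for unbounded sets.  The covering number is \<open>\<infinity>\<close> if there is no finite cover.\<close>

definition covering_number :: "real \<Rightarrow> 'a::metric_space set \<Rightarrow> ennreal" where
  "covering_number \<delta> E = Inf {of_nat (card \<U>) |\<U>.
     finite \<U> \<and> (\<forall>U \<in> \<U>. bounded U \<and> diameter U \<le> \<delta>) \<and> E \<subseteq> \<Union>\<U>}"

definition packing_premeasure :: "real \<Rightarrow> 'a::metric_space set \<Rightarrow> ennreal" where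
  "packing_premeasure s E =
     Liminf (at_right 0) (\<lambda>\<delta>. covering_number \<delta> E * ennreal (\<delta> powr s))"

definition lower_packing_measure :: "real \<Rightarrow> 'a::metric_space set \<Rightarrow> ennreal" where
  "lower_packing_measure s E =
     Inf {(\<Sum>n. packing_premeasure s (F n)) |F :: nat \<Rightarrow> 'a set. E \<subseteq> (\<Union>n. F n)}"

definition lower_packing_dim :: "'a::metric_space set \<Rightarrow> ennreal" where
  "lower_packing_dim E = Sup {ennreal s |s. 0 < s \<and> lower_packing_measure s E > 0}"


section \<open>Hausdorff dimension\<close>

definition hausdorff_premeasure :: "real \<Rightarrow> real \<Rightarrow> 'a::metric_space set \<Rightarrow> ennreal" where
  "hausdorff_premeasure s \<delta> E =
     Inf {(\<Sum>n. ennreal (diameter (U n) powr s)) |U :: nat \<Rightarrow> 'a set.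
       (\<forall>n. bounded (U n) \<and> diameter (U n) \<le> \<delta>) \<and> E \<subseteq> (\<Union>n. U n)}"

definition hausdorff_measure :: "real \<Rightarrow> 'a::metric_space set \<Rightarrow> ennreal" where
  "hausdorff_measure s E = (SUP \<delta> \<in> {0<..}. hausdorff_premeasure s \<delta> E)"

text \<open>Only exponents \<open>s > 0\<close> are used, so the value of \<open>0 powr 0\<close> is irrelevant.\<close>

definition hausdorff_dim :: "'a::metric_space set \<Rightarrow> ennreal" where
  "hausdorff_dim E = Inf {ennreal s |s. 0 < s \<and> hausdorff_measure s E = 0}"

end

(*
  Let e n = (1/2)^(n+1) and let K n be compact sets increasing to \<Omega>. Given n, a continuous function can be
  perturbed slightly so as to be constant on each of finitely many disjoint compact pieces of K n;
  the part T of K n outside the pieces is contained in arbitrarily thin spherical shells. Hence T is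
  covered by about t^(1-d) balls of radius t, and every point of T has next to it a hole of T of
  relative size 1 - e n, because the pieces are essentially balls from which earlier balls were removed.
  That K n - T is mapped into an open set U covered by few, very short intervals is an open
  condition on the function, so a typical function satisfies it for every n, with some T n and U n.
  Then A = liminf T n has the required properties: if x is not in A, then f x lies in limsup U n,
  which has Hausdorff dimension zero.
*)
theory Submission
  imports Defs
begin

section \<open>Covering thin spherical shells\<close>

lemma power_diff_le:
  fixes a b :: real
  assumes "0 \<le> b" "b \<le> a"
  shows "a ^ n - b ^ n \<le> real n * (a - b) * a ^ (n - 1)"
proof (induction n)
  case (Suc n)
  have "a ^ Suc n - b ^ Suc n = a * (a ^ n - b ^ n) + (a - b) * b ^ n"
    by (simp add: algebra_simps)
  also have "\<dots> \<le> a * (real n * (a - b) * a ^ (n - 1)) + (a - b) * a ^ n"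
    using assms Suc by (intro add_mono mult_left_mono power_mono) auto
  also have "\<dots> = real (Suc n) * (a - b) * a ^ n"
    by (cases n) (simp_all add: algebra_simps)
  finally show ?case by simp
qed simp

text \<open>Volume comparison: the balls of radius \<open>t/2\<close> about the points are disjoint
  and lie in a shell of thickness \<open>4 * t\<close>, whose volume is at most linear in
  \<open>t\<close> by \<open>power_diff_le\<close>. Dividing by the volume of one ball, of order
  \<open>t ^ d\<close>, leaves \<open>t powr (1 - d)\<close>, where \<open>d\<close> is the
  dimension.\<close>

lemma separated_subset_shell_card_le:
  fixes c :: "'a::euclidean_space"
  assumes t: "0 < t" "2 * t \<le> \<rho>" and fin: "finite P"
    and shell: "P \<subseteq> {x. \<rho> - t \<le> dist c x \<and> dist c x \<le> \<rho> + t}"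
    and sep: "\<And>p q. p \<in> P \<Longrightarrow> q \<in> P \<Longrightarrow> p \<noteq> q \<Longrightarrow> t < dist p q"
  shows "real (card P) * t ^ (DIM('a) - 1) \<le> 2 ^ DIM('a) * real DIM('a) * 4 * (2 * \<rho>) ^ (DIM('a) - 1)"
proof -
  let ?d = "DIM('a)"
  let ?V = "unit_ball_vol (real ?d)"
  have V: "?V > 0" by (rule unit_ball_vol_pos) simp
  have disj: "disjoint_family_on (\<lambda>p. ball p (t/2)) P"
  proof (clarsimp simp: disjoint_family_on_def disjoint_iff)
    fix p q x assume "p \<in> P" "q \<in> P" "p \<noteq> q" "dist p x * 2 < t" "dist q x * 2 < t"
    then show False using sep[of p q] dist_triangle2[of p q x] by linarith
  qed
  have "real (card P) * (?V * (t/2) ^ ?d) = (\<Sum>p\<in>P. measure lebesgue (ball p (t/2)))"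
    using t by (simp add: content_ball)
  also have "\<dots> = measure lebesgue (\<Union>p\<in>P. ball p (t/2))"
    using fin disj by (intro measure_finite_Union[symmetric]) (auto simp: emeasure_lborel_ball_finite[THEN less_imp_neq, unfolded infinity_ennreal_def])
  also have "\<dots> \<le> measure lebesgue (ball c (\<rho> + 2*t) - ball c (\<rho> - 2*t))"
  proof (rule measure_mono_fmeasurable)
    show "(\<Union>p\<in>P. ball p (t/2)) \<subseteq> ball c (\<rho> + 2*t) - ball c (\<rho> - 2*t)"
    proof clarsimp
      fix p x assume "p \<in> P" "dist p x * 2 < t"
      moreover have "\<rho> - t \<le> dist c p" "dist c p \<le> \<rho> + t" using shell \<open>p \<in> P\<close> by auto
      ultimately show "dist c x < \<rho> + 2 * t \<and> \<not> dist c x < \<rho> - 2 * t"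
        using t dist_triangle[of c x p] dist_triangle2[of c p x] by linarith
    qed
  qed (auto intro: fin)
  also have "\<dots> = measure lebesgue (ball c (\<rho> + 2*t)) - measure lebesgue (ball c (\<rho> - 2*t))"
    using t by (intro measurable_measure_Diff) (auto intro: subset_ball)
  also have "\<dots> = ?V * ((\<rho> + 2*t) ^ ?d - (\<rho> - 2*t) ^ ?d)"
    using t by (simp add: content_ball algebra_simps)
  also have "\<dots> \<le> ?V * (real ?d * ((\<rho> + 2*t) - (\<rho> - 2*t)) * (\<rho> + 2*t) ^ (?d - 1))"
    using t V by (intro mult_left_mono power_diff_le) auto
  \<comment> \<open>By \<open>2 * t \<le> \<rho>\<close> the base of the power can be made
    independent of \<open>t\<close>.\<close>
  also have "\<dots> \<le> ?V * (real ?d * ((\<rho> + 2*t) - (\<rho> - 2*t)) * (2*\<rho>) ^ (?d - 1))"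
    using t V by (intro mult_left_mono power_mono) auto
  finally have "?V * (real (card P) * (t/2) ^ ?d) \<le> ?V * (real ?d * (4 * t) * (2*\<rho>) ^ (?d - 1))"
    by (simp add: mult_ac)
  with V have "real (card P) * (t/2) ^ ?d \<le> real ?d * (4 * t) * (2*\<rho>) ^ (?d - 1)"
    by (simp only: mult_le_cancel_left_pos)
  then have "real (card P) * t ^ ?d \<le> 2 ^ ?d * (real ?d * (4 * t) * (2*\<rho>) ^ (?d - 1))"
    by (simp add: power_divide field_simps)
  then have "t * (real (card P) * t ^ (?d - 1)) \<le> t * (2 ^ ?d * real ?d * 4 * (2*\<rho>) ^ (?d - 1))"
    by (subst (asm) power_eq_if) (simp add: mult_ac)
  then show ?thesis using t by (simp only: mult_le_cancel_left_pos)
qed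

text \<open>A \<open>t\<close>-separated set of maximal cardinality serves as \<open>P\<close>: by
  maximality every point of the shell is within \<open>t\<close> of it. The bound on the cardinality
  of separated sets guarantees that a maximal one exists.\<close>

lemma shell_cover:
  fixes c :: "'a::euclidean_space"
  assumes t: "0 < t" "2 * t \<le> \<rho>"
  obtains P where "finite P"
    and "{x. \<rho> - t \<le> dist c x \<and> dist c x \<le> \<rho> + t} \<subseteq> (\<Union>p\<in>P. cball p t)"
    and "real (card P) * t ^ (DIM('a) - 1) \<le> 2 ^ DIM('a) * real DIM('a) * 4 * (2 * \<rho>) ^ (DIM('a) - 1)"
proof -
  let ?S = "{x. \<rho> - t \<le> dist c x \<and> dist c x \<le> \<rho> + t}"
  let ?B = "2 ^ DIM('a) * real DIM('a) * 4 * (2 * \<rho>) ^ (DIM('a) - 1)"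
  define sep where "sep = (\<lambda>P. finite P \<and> P \<subseteq> ?S \<and> (\<forall>p\<in>P. \<forall>q\<in>P. p \<noteq> q \<longrightarrow> t < dist p q))"
  have bound: "real (card P) * t ^ (DIM('a) - 1) \<le> ?B" if "sep P" for P
    using that t unfolding sep_def by (intro separated_subset_shell_card_le) auto
  have "sep {}" by (simp add: sep_def)
  moreover have "\<forall>P. sep P \<longrightarrow> card P < Suc (nat \<lceil>?B / t ^ (DIM('a) - 1)\<rceil>)"
  proof (intro allI impI)
    fix P assume "sep P"
    then have "real (card P) \<le> ?B / t ^ (DIM('a) - 1)"
      using bound t by (simp add: pos_le_divide_eq)
    then show "card P < Suc (nat \<lceil>?B / t ^ (DIM('a) - 1)\<rceil>)" by linarith
  qed
  ultimately obtain P where P: "sep P" "\<And>Q. sep Q \<Longrightarrow> card Q \<le> card P"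
    using ex_has_greatest_nat[of sep "{}" card] by blast
  have "\<exists>p\<in>P. dist p x \<le> t" if "x \<in> ?S" for x
  proof (rule ccontr)
    assume "\<not> ?thesis"
    then have far: "\<And>p. p \<in> P \<Longrightarrow> t < dist p x" by auto
    then have "x \<notin> P" using t by fastforce
    have "sep (insert x P)"
      using P(1) far that unfolding sep_def by (auto simp: dist_commute)
    from P(2)[OF this] \<open>x \<notin> P\<close> P(1) show False by (simp add: sep_def)
  qed
  then have "?S \<subseteq> (\<Union>p\<in>P. cball p t)" by auto
  then show thesis using that[of P] P(1) bound[OF P(1)] by (simp add: sep_def)
qed

section \<open>Cells and the holes next to points outside them\<close>

text \<open>Shrinking the ball and thickening the earlier balls by the same \<open>t\<close> leaves
  gaps between the cells. The removed balls are open, so that cells are closed.\<close>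

definition cell :: "(nat \<Rightarrow> 'a::metric_space) \<Rightarrow> real \<Rightarrow> real \<Rightarrow> nat \<Rightarrow> 'a set" where
  "cell c \<rho> t i = cball (c i) (\<rho> - t) - (\<Union>j<i. ball (c j) (\<rho> + t))"

lemma closed_cell: "closed (cell c \<rho> t i)"
  unfolding cell_def by (intro closed_Diff open_UN) auto

lemma disjoint_cells:
  assumes "0 < t"
  shows "disjoint_family (cell c \<rho> t)"
proof -
  have "cell c \<rho> t i \<inter> cell c \<rho> t j = {}" if "i < j" for i j
    using that assms by (force simp: cell_def)
  then show ?thesis
    unfolding disjoint_family_on_def by (metis Int_commute linorder_neqE_nat)
qed

text \<open>Take the first \<open>i\<close> whose thickened ball contains the point. No earlier ball
  excludes the point from cell \<open>i\<close>, so it can only miss that cell by being too far from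
  \<open>c i\<close>.\<close>

lemma outside_cells_subset_shells:
  assumes "0 < t" "K \<subseteq> (\<Union>i<N. ball (c i) \<rho>)"
  shows "K - (\<Union>i<N. cell c \<rho> t i) \<subseteq> (\<Union>i<N. {x. \<rho> - t \<le> dist (c i) x \<and> dist (c i) x \<le> \<rho> + t})"
proof
  fix x assume x: "x \<in> K - (\<Union>i<N. cell c \<rho> t i)"
  define i where "i = (LEAST i. x \<in> ball (c i) (\<rho> + t))"
  obtain k where k: "k < N" "x \<in> ball (c k) (\<rho> + t)" using x assms by fastforce
  then have i: "x \<in> ball (c i) (\<rho> + t)" "i \<le> k"
    unfolding i_def by (auto intro: LeastI Least_le simp del: mem_ball)
  have "x \<notin> ball (c j) (\<rho> + t)" if "j < i" for j
    using that not_less_Least unfolding i_def by blast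
  moreover have "x \<notin> cell c \<rho> t i" using x i k by auto
  ultimately have "\<rho> - t < dist (c i) x" by (auto simp: cell_def)
  with i k show "x \<in> (\<Union>i<N. {x. \<rho> - t \<le> dist (c i) x \<and> dist (c i) x \<le> \<rho> + t})"
    by (intro UN_I[of i]) auto
qed

text \<open>\<open>N\<close> strict decreases in a row cannot start below \<open>N\<close>. This
  will provide two consecutive scales with the same first ball.\<close>

lemma nat_antimono_stationary:
  fixes i :: "nat \<Rightarrow> nat"
  assumes "antimono i" "i 0 < N"
  obtains m where "m < N" "i (Suc m) = i m"
proof -
  have "\<exists>m<N. i (Suc m) = i m"
  proof (rule ccontr)
    assume "\<not> ?thesis"
    then have dec: "i (Suc m) < i m" if "m < N" for m
      using that assms(1) by (metis antimonoD le_SucI order_refl nless_le)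
    have "i m + m \<le> i 0" if "m \<le> N" for m
      using that
    proof (induction m)
      case (Suc m)
      then show ?case using dec[of m] by simp
    qed simp
    from this[of N] assms(2) show False by simp
  qed
  then show thesis using that by blast
qed

text \<open>At scale \<open>k ^ m * t\<close> let \<open>i m\<close> be the first ball whose thickening contains \<open>x\<close>. The
  indices decrease with the scale, so two consecutive ones coincide; between these two scales only
  the ball \<open>i m\<close> is visible among the first \<open>i m\<close> ones, and the hole lies inside it, almost tangent
  to its boundary at \<open>x\<close>.\<close>

lemma hole_outside_cells:
  fixes c :: "nat \<Rightarrow> 'a::euclidean_space"
  assumes t: "0 < t" and e: "0 < e" "e < 1" and k: "k = 1 + 4 / e"
    and small: "2 * k ^ N * t / e \<le> \<rho> - t"
    and x: "x \<in> (\<Union>i<N. ball (c i) \<rho>)" "x \<notin> (\<Union>i<N. cell c \<rho> t i)"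
  obtains r y i where "0 < r" "r \<le> 2 * k ^ N * t / e" "y \<in> cball x r" "i < N"
    "cball y ((1 - e) * r) \<subseteq> cell c \<rho> t i"
proof -
  have k1: "1 \<le> k" using e k by simp
  define i where "i m = (LEAST i. dist (c i) x < \<rho> + k ^ m * t)" for m
  obtain i0 where i0: "i0 < N" "dist (c i0) x < \<rho>" using x(1) by auto
  have near0: "dist (c i0) x < \<rho> + k ^ m * t" for m
    using i0 k1 t by (smt (verit) mult_pos_pos zero_less_power)
  have near: "dist (c (i m)) x < \<rho> + k ^ m * t" for m
    unfolding i_def by (rule LeastI, rule near0)
  have far: "\<rho> + k ^ m * t \<le> dist (c j) x" if "j < i m" for j m
    using not_less_Least[OF that[unfolded i_def]] by simp
  have "antimono i"
  proof (rule antimonoI)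
    fix m n :: nat assume "m \<le> n"
    then have "k ^ m * t \<le> k ^ n * t" using k1 t by (simp add: power_increasing)
    then show "i n \<le> i m"
      using near[of m] unfolding i_def[of n] by (intro Least_le) linarith
  qed
  moreover have i_less: "i m < N" for m
    using Least_le[of "\<lambda>i. dist (c i) x < \<rho> + k ^ m * t", OF near0] i0 by (simp add: i_def)
  ultimately obtain m where m: "m < N" "i (Suc m) = i m"
    using nat_antimono_stationary by blast
  define j where "j = i m"
  \<comment> \<open>A hole of relative radius \<open>1 - e\<close> leaves the slack
    \<open>r * e\<close>. Here it equals \<open>2 * (k ^ m * t)\<close>: one half pays for the
    distance by which \<open>x\<close> may lie outside the ball of radius \<open>\<rho>\<close>, the
    other for the shrinking by \<open>t\<close>.\<close>
  define r where "r = 2 * (k ^ m * t) / e"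
  have tm: "t \<le> k ^ m * t" using k1 t by simp
  then have r: "0 < r" using t e by (simp add: r_def)
  have re: "r * e = 2 * (k ^ m * t)" using e by (simp add: r_def)
  \<comment> \<open>The value of \<open>k\<close> makes the thickening grow by exactly
    \<open>2 * r\<close> from one scale to the next, so that the thickened earlier balls stay away
    from everything within \<open>2 * r\<close> of \<open>x\<close>.\<close>
  have kr: "k ^ Suc m * t = k ^ m * t + 2 * r"
    by (simp add: r_def k field_simps)
  have "k ^ m * t \<le> k ^ N * t" using k1 t m by (simp add: power_increasing)
  then have rN: "r \<le> 2 * k ^ N * t / e" using e by (simp add: r_def divide_right_mono)
  have farj: "\<rho> + k ^ m * t + 2 * r \<le> dist (c l) x" if "l < j" for l
    using far[of l "Suc m"] that m kr by (simp add: j_def)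
  \<comment> \<open>Otherwise \<open>x\<close> would lie in cell \<open>j\<close>, since
    \<open>farj\<close> keeps it out of the earlier balls. Together with \<open>small\<close> this
    gives \<open>r \<le> D\<close>, so that moving \<open>x\<close> by \<open>r\<close> towards
    \<open>c j\<close> does not overshoot the centre.\<close>
  have dj: "\<rho> - t < dist (c j) x"
  proof (rule ccontr)
    assume "\<not> ?thesis"
    then have "x \<in> cell c \<rho> t j"
      using farj r tm by (fastforce simp: cell_def)
    then show False using x(2) i_less by (auto simp: j_def)
  qed
  define D where "D = dist (c j) x"
  have D: "0 < D" "r \<le> D" "D < \<rho> + k ^ m * t"
    using dj small rN r near[of m] by (auto simp: D_def j_def)
  define y where "y = x - (r / D) *\<^sub>R (x - c j)"
  have xy: "dist x y = r"
    using D r by (simp add: y_def dist_norm D_def norm_minus_commute)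
  have "y - c j = (1 - r / D) *\<^sub>R (x - c j)" by (simp add: y_def algebra_simps)
  then have "dist (c j) y = \<bar>1 - r / D\<bar> * D"
    by (metis D_def dist_commute dist_norm norm_scaleR)
  also have "\<dots> = (1 - r / D) * D" using D by simp
  also have "\<dots> = D - r" using D by (simp add: left_diff_distrib)
  finally have cy: "dist (c j) y = D - r" .
  have "z \<in> cell c \<rho> t j" if z: "dist y z \<le> (1 - e) * r" for z
  proof -
    have z': "dist y z \<le> r - r * e" using z by (simp add: algebra_simps)
    have "dist (c j) z \<le> \<rho> - t"
      using dist_triangle[of "c j" z y] cy z' D re tm by linarith
    moreover have "\<rho> + t \<le> dist (c l) z" if "l < j" for l
    proof -
      have "dist (c l) x \<le> dist (c l) z + dist z x" by (rule dist_triangle)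
      moreover have "dist z x \<le> dist x y + dist y z"
        using dist_triangle[of x z y] by (simp add: dist_commute)
      ultimately show ?thesis
        using farj[OF that] z' xy tm mult_pos_pos[OF r e(1)] by linarith
    qed
    ultimately show ?thesis by (fastforce simp: cell_def)
  qed
  then have "cball y ((1 - e) * r) \<subseteq> cell c \<rho> t j" by auto
  moreover have "y \<in> cball x r" using xy by simp
  moreover have "j < N" using i_less by (simp add: j_def)
  ultimately show thesis using that r rN by blast
qed

section \<open>Sets that are thin and porous at one scale\<close>

text \<open>A one-scale form of lower packing dimension at most \<open>s\<close>. The single
  parameter \<open>e\<close> bounds the scale, the loss in the exponent and the covering sum, so
  that a sequence of \<open>e\<close> tending to 0 controls all three. With \<open>s = 0\<close> it
  also serves for Hausdorff dimension zero.\<close>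

definition thinly_covered :: "real \<Rightarrow> real \<Rightarrow> 'a::metric_space set \<Rightarrow> bool" where
  "thinly_covered s e E \<longleftrightarrow> (\<exists>\<delta> \<U>. 0 < \<delta> \<and> \<delta> < e \<and> finite \<U> \<and>
     (\<forall>U\<in>\<U>. bounded U \<and> diameter U \<le> \<delta>) \<and> E \<subseteq> \<Union>\<U> \<and> real (card \<U>) * \<delta> powr (s + e) \<le> e)"

text \<open>A one-scale form of strong porosity; the radius \<open>r\<close> may depend on the
  point.\<close>

definition porous_below :: "real \<Rightarrow> 'a::metric_space set \<Rightarrow> bool" where
  "porous_below e T \<longleftrightarrow>
     (\<forall>x\<in>T. \<exists>r y. 0 < r \<and> r < e \<and> y \<in> cball x r \<and> cball y ((1 - e) * r) \<inter> T = {})"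

lemma thinly_covered_subset: "thinly_covered s e F \<Longrightarrow> E \<subseteq> F \<Longrightarrow> thinly_covered s e E"
  unfolding thinly_covered_def by (meson order_trans)

lemma porous_below_subset: "porous_below e F \<Longrightarrow> E \<subseteq> F \<Longrightarrow> porous_below e E"
  unfolding porous_below_def by (meson disjoint_iff subsetD)

lemma eventually_mult_powr_less:
  fixes e b :: real
  assumes "0 < e" "0 < b"
  shows "eventually (\<lambda>t. A * t powr e < b) (at_right 0)"
proof -
  have "((\<lambda>t. A * t powr e) \<longlongrightarrow> A * 0 powr e) (at_right 0)"
    using assms by (intro tendsto_intros tendsto_powr') (auto simp: eventually_at_right_less eventually_at_filter)
  then show ?thesis using order_tendstoD(2) assms by fastforce
qed

text \<open>The set lies in \<open>N\<close> shells, each covered by balls of radius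
  \<open>t\<close>. Their total number times \<open>(2 * t) ^ (d - 1)\<close>, with \<open>d\<close>
  the dimension, is at most \<open>B\<close>, which does not depend on \<open>t\<close>; the extra
  factor \<open>(2 * t) powr e\<close> makes the product small.\<close>

lemma outside_cells_thinly_covered:
  fixes c :: "nat \<Rightarrow> 'a::euclidean_space"
  assumes t: "0 < t" "2 * t \<le> \<rho>" "2 * t < e" and K: "K \<subseteq> (\<Union>i<N. ball (c i) \<rho>)"
    and B: "B = real N * (2 ^ DIM('a) * real DIM('a) * 4 * (2 * \<rho>) ^ (DIM('a) - 1)) * 2 ^ (DIM('a) - 1)"
    and small: "B * (2 * t) powr e \<le> e"
  shows "thinly_covered (real DIM('a) - 1) e (K - (\<Union>i<N. cell c \<rho> t i))"
proof -
  let ?b = "2 ^ DIM('a) * real DIM('a) * 4 * (2 * \<rho>) ^ (DIM('a) - 1)"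
  have "\<exists>P. finite P \<and> {x. \<rho> - t \<le> dist (c i) x \<and> dist (c i) x \<le> \<rho> + t} \<subseteq> (\<Union>p\<in>P. cball p t) \<and>
      real (card P) * t ^ (DIM('a) - 1) \<le> ?b" for i
    by (rule shell_cover[OF t(1,2), of "c i"]) blast
  then have "\<exists>P. \<forall>i. finite (P i) \<and> {x. \<rho> - t \<le> dist (c i) x \<and> dist (c i) x \<le> \<rho> + t} \<subseteq> (\<Union>p\<in>P i. cball p t) \<and>
      real (card (P i)) * t ^ (DIM('a) - 1) \<le> ?b"
    by (intro choice allI)
  then obtain P where P: "\<And>i. finite (P i)"
      "\<And>i. {x. \<rho> - t \<le> dist (c i) x \<and> dist (c i) x \<le> \<rho> + t} \<subseteq> (\<Union>p\<in>P i. cball p t)"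
      "\<And>i. real (card (P i)) * t ^ (DIM('a) - 1) \<le> ?b"
    by blast
  define \<U> where "\<U> = (\<Union>i<N. (\<lambda>p. cball p t) ` P i)"
  have "card \<U> \<le> (\<Sum>i<N. card ((\<lambda>p. cball p t) ` P i))"
    unfolding \<U>_def by (rule card_UN_le) simp
  also have "\<dots> \<le> (\<Sum>i<N. card (P i))" by (intro sum_mono card_image_le P)
  finally have "real (card \<U>) * t ^ (DIM('a) - 1) \<le> (\<Sum>i<N. real (card (P i)) * t ^ (DIM('a) - 1))"
    using t by (simp add: sum_distrib_right[symmetric] flip: of_nat_sum)
  also have "\<dots> \<le> real N * ?b" using sum_mono[of "{..<N}", OF P(3)] by simp
  finally have card: "real (card \<U>) * t ^ (DIM('a) - 1) \<le> real N * ?b" .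
  have "(2 * t) powr (real DIM('a) - 1 + e) = (2 * t) ^ (DIM('a) - 1) * (2 * t) powr e"
  proof -
    have "real DIM('a) - 1 = real (DIM('a) - 1)" by (simp add: of_nat_diff Suc_leI)
    then show ?thesis using t by (simp only: powr_add powr_realpow mult_pos_pos zero_less_numeral)
  qed
  then have "real (card \<U>) * (2 * t) powr (real DIM('a) - 1 + e)
      = (real (card \<U>) * t ^ (DIM('a) - 1)) * 2 ^ (DIM('a) - 1) * (2 * t) powr e"
    by (simp add: power_mult_distrib)
  also have "\<dots> \<le> B * (2 * t) powr e"
    unfolding B using card by (intro mult_right_mono) auto
  finally have "real (card \<U>) * (2 * t) powr (real DIM('a) - 1 + e) \<le> e" using small by simp
  moreover have "K - (\<Union>i<N. cell c \<rho> t i) \<subseteq> \<Union>\<U>"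
  proof
    fix x assume "x \<in> K - (\<Union>i<N. cell c \<rho> t i)"
    then obtain i where "i < N" "x \<in> {x. \<rho> - t \<le> dist (c i) x \<and> dist (c i) x \<le> \<rho> + t}"
      using outside_cells_subset_shells[OF t(1) K] by blast
    then obtain p where "p \<in> P i" "x \<in> cball p t" using P(2)[of i] by blast
    with \<open>i < N\<close> show "x \<in> \<Union>\<U>" unfolding \<U>_def by blast
  qed
  moreover have "bounded U \<and> diameter U \<le> 2 * t" if "U \<in> \<U>" for U
    using that t by (auto simp: \<U>_def diameter_cball)
  ultimately show ?thesis
    unfolding thinly_covered_def using t P(1) by (intro exI[of _ "2 * t"] exI[of _ \<U>]) (auto simp: \<U>_def)
qed

text \<open>Compactness yields the centres and their number before \<open>t\<close> is chosen. Hence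
  \<open>B\<close> and \<open>k ^ N\<close> are constants as \<open>t\<close> tends to 0, and every
  requirement on \<open>t\<close> holds for all small \<open>t\<close>.\<close>

lemma porous_complement_of_cells:
  fixes K :: "'a::euclidean_space set"
  assumes K: "compact K" and e: "0 < e" "e < 1" and \<rho>: "0 < \<rho>"
  shows "\<exists>(N::nat) c C. (\<forall>i<N. c i \<in> K) \<and> (\<forall>i. closed (C i) \<and> C i \<subseteq> cball (c i) \<rho>) \<and>
    disjoint_family C \<and> thinly_covered (real DIM('a) - 1) e (K - (\<Union>i<N. C i)) \<and>
    porous_below e (K - (\<Union>i<N. C i))"
proof -
  obtain D where D: "D \<subseteq> K" "finite D" "K \<subseteq> (\<Union>x\<in>D. ball x \<rho>)"
  proof (rule compactE_image[OF K, of K "\<lambda>x. ball x \<rho>"])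
    show "K \<subseteq> (\<Union>x\<in>K. ball x \<rho>)" using \<rho> by auto
  qed auto
  define N where "N = card D"
  obtain c where c: "bij_betw c {..<N} D"
    using ex_bij_betw_nat_finite[OF D(2)] by (auto simp: N_def lessThan_atLeast0)
  then have cD: "c ` {..<N} = D" by (simp add: bij_betw_def)
  then have cov: "K \<subseteq> (\<Union>i<N. ball (c i) \<rho>)" using D(3) by blast
  define k where "k = 1 + 4 / e"
  define B where
    "B = real N * (2 ^ DIM('a) * real DIM('a) * 4 * (2 * \<rho>) ^ (DIM('a) - 1)) * 2 ^ (DIM('a) - 1)"
  have lin: "\<forall>\<^sub>F t in at_right 0. a * t < b" if "0 < b" for a b :: real
    using eventually_mult_powr_less[of 1 b a] that eventually_at_right_less[of 0]
    by (auto elim: eventually_elim2)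
  \<comment> \<open>The fourth condition yields the thin covering, the fifth keeps the radius of the
    holes below \<open>e\<close>, and the sixth is the assumption \<open>small\<close> of
    \<open>hole_outside_cells\<close>.\<close>
  have "\<forall>\<^sub>F t in at_right 0. 0 < t \<and> 2 * t < \<rho> \<and> 2 * t < e \<and> (B * 2 powr e) * t powr e < e \<and>
      2 * k ^ N / e * t < e \<and> (2 * k ^ N / e + 1) * t < \<rho>"
    by (intro eventually_conj lin eventually_mult_powr_less eventually_at_right_less e \<rho>)
  then obtain t where t: "0 < t" "2 * t < \<rho>" "2 * t < e" "(B * 2 powr e) * t powr e < e"
      "2 * k ^ N / e * t < e" "(2 * k ^ N / e + 1) * t < \<rho>"
    using eventually_happens'[OF trivial_limit_at_right_real] by blast
  have "thinly_covered (real DIM('a) - 1) e (K - (\<Union>i<N. cell c \<rho> t i))"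
    using t cov by (intro outside_cells_thinly_covered[OF _ _ _ _ B_def]) (auto simp: powr_mult mult.assoc)
  moreover have "porous_below e (K - (\<Union>i<N. cell c \<rho> t i))"
    unfolding porous_below_def
  proof
    fix x assume x: "x \<in> K - (\<Union>i<N. cell c \<rho> t i)"
    have "2 * k ^ N * t / e \<le> \<rho> - t" using t(6) by (simp add: algebra_simps)
    moreover have "x \<in> (\<Union>i<N. ball (c i) \<rho>)" "x \<notin> (\<Union>i<N. cell c \<rho> t i)"
      using x cov by blast+
    ultimately show "\<exists>r y. 0 < r \<and> r < e \<and> y \<in> cball x r \<and>
        cball y ((1 - e) * r) \<inter> (K - (\<Union>i<N. cell c \<rho> t i)) = {}"
    proof (rule hole_outside_cells[OF t(1) e k_def])
      fix r y i assume *: "0 < r" "r \<le> 2 * k ^ N * t / e" "y \<in> cball x r" "i < N"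
        "cball y ((1 - e) * r) \<subseteq> cell c \<rho> t i"
      have "2 * k ^ N * t / e < e" using t(5) by simp
      with *(2) have "r < e" by linarith
      moreover have "cball y ((1 - e) * r) \<inter> (K - (\<Union>i<N. cell c \<rho> t i)) = {}"
        using *(4,5) by blast
      ultimately show ?thesis using *(1,3) by blast
    qed
  qed
  moreover have "c i \<in> K" if "i < N" for i using that cD D(1) by blast
  moreover have "cell c \<rho> t i \<subseteq> cball (c i) \<rho>" for i using t by (auto simp: cell_def)
  ultimately show ?thesis
    using closed_cell disjoint_cells[OF t(1)]
    by (intro exI[of _ N] exI[of _ c] exI[of _ "cell c \<rho> t"] conjI allI impI)
qed

section \<open>Tame functions in the compact-open topology\<close>

text \<open>Uniform closeness on \<open>S\<close> refines the compact-open topology. The induction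
  follows the generation of \<open>W\<close>; for a subbasic set, the compact image of
  \<open>K\<close> has a uniform neighbourhood inside \<open>U\<close>.\<close>

lemma openin_compact_open_nbhd:
  assumes "openin (compact_open_topology S) W" "f \<in> W"
  obtains \<eta> where "0 < \<eta>"
    "\<And>g. g \<in> continuous_functions S \<Longrightarrow> (\<And>x. x \<in> S \<Longrightarrow> \<bar>g x - f x\<bar> < \<eta>) \<Longrightarrow> g \<in> W"
proof -
  let ?near = "\<lambda>f \<eta> g. g \<in> continuous_functions S \<and> (\<forall>x\<in>S. \<bar>g x - f x\<bar> < \<eta>)"
  have "\<exists>\<eta>>0. \<forall>g. ?near f \<eta> g \<longrightarrow> g \<in> W"
    using openin_topology_generated_by[OF assms(1)[unfolded compact_open_topology_def]] assms(2)
  proof induction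
    case (Int a b)
    then obtain \<alpha> \<beta> where "\<alpha> > 0" "\<forall>g. ?near f \<alpha> g \<longrightarrow> g \<in> a" "\<beta> > 0" "\<forall>g. ?near f \<beta> g \<longrightarrow> g \<in> b"
      by auto
    then show ?case by (intro exI[of _ "min \<alpha> \<beta>"]) auto
  next
    case (UN K)
    then obtain k where "k \<in> K" "f \<in> k" by blast
    with UN.IH[of k] show ?case by blast
  next
    case (Basis s)
    then obtain K U where s: "s = {f \<in> continuous_functions S. f ` K \<subseteq> U}" "compact K" "K \<subseteq> S" "open U"
      by blast
    with Basis have f: "continuous_on S f" "f ` K \<subseteq> U" by (auto simp: continuous_functions_def)
    then have "compact (f ` K)"
      using s by (meson compact_continuous_image continuous_on_subset)
    then obtain \<eta> where \<eta>: "0 < \<eta>" "(\<Union>y\<in>f ` K. ball y \<eta>) \<subseteq> U"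
      using compact_subset_open_imp_ball_epsilon_subset s(4) f(2) by blast
    have "g \<in> s" if g: "?near f \<eta> g" for g
    proof -
      have "g x \<in> U" if "x \<in> K" for x
      proof -
        have "g x \<in> ball (f x) \<eta>" using g that s(3) by (auto simp: dist_real_def abs_minus_commute)
        then show ?thesis using \<eta>(2) that by blast
      qed
      then show ?thesis using g s(1) by auto
    qed
    with \<eta>(1) show ?case by blast
  qed auto
  then show thesis using that by blast
qed

definition tame_functions :: "'a::euclidean_space set \<Rightarrow> 'a set \<Rightarrow> real \<Rightarrow> ('a \<Rightarrow> real) set" where
  "tame_functions S K e = {f \<in> continuous_functions S. \<exists>L U. compact L \<and> L \<subseteq> K \<and> open U \<and> f ` L \<subseteq> U \<and>
     thinly_covered (real DIM('a) - 1) e (K - L) \<and> porous_below e (K - L) \<and> thinly_covered 0 e U}"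

lemma openin_tame_functions:
  assumes "K \<subseteq> S"
  shows "openin (compact_open_topology S) (tame_functions S K e)"
proof -
  have "tame_functions S K e = \<Union>{{f \<in> continuous_functions S. f ` L \<subseteq> U} |L U.
      compact L \<and> L \<subseteq> K \<and> open U \<and> thinly_covered (real DIM('a) - 1) e (K - L) \<and>
      porous_below e (K - L) \<and> thinly_covered 0 e U}"
    unfolding tame_functions_def by blast
  moreover have "openin (compact_open_topology S) {f \<in> continuous_functions S. f ` L \<subseteq> U}"
    if "compact L" "L \<subseteq> K" "open U" for L U
    unfolding compact_open_topology_def using that assms by (intro topology_generated_by_Basis) blast
  ultimately show ?thesis by (auto intro!: openin_Union)
qed

lemma thinly_covered_nbhd_finite:
  fixes Y :: "'a::euclidean_space set"
  assumes "finite Y" "0 < e"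
  obtains U where "open U" "Y \<subseteq> U" "thinly_covered 0 e U"
proof -
  have "\<forall>\<^sub>F t in at_right 0. 0 < t \<and> 1 * t powr 1 < e \<and> real (card Y) * t powr e < e"
    by (intro eventually_conj eventually_mult_powr_less eventually_at_right_less assms zero_less_one)
  then obtain t where "0 < t \<and> 1 * t powr 1 < e \<and> real (card Y) * t powr e < e"
    using eventually_happens'[OF trivial_limit_at_right_real] by blast
  then have t: "0 < t" "t < e" "real (card Y) * t powr e < e" by auto
  let ?U = "(\<lambda>y. ball y (t/2)) ` Y"
  have "real (card ?U) * t powr e \<le> real (card Y) * t powr e"
    by (intro mult_right_mono) (simp_all add: card_image_le assms(1))
  with t(3) have "real (card ?U) * t powr e \<le> e" by linarith
  then have "thinly_covered 0 e (\<Union>?U)"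
    unfolding thinly_covered_def using t(1,2) assms(1)
    by (intro exI[of _ t] exI[of _ ?U] conjI) (auto simp del: UN_simps)
  moreover have "open (\<Union>?U)" by blast
  moreover have "Y \<subseteq> \<Union>?U"
  proof
    fix y assume "y \<in> Y"
    moreover have "y \<in> ball y (t/2)" using t by simp
    ultimately show "y \<in> \<Union>?U" by blast
  qed
  ultimately show thesis by (intro that)
qed

text \<open>On the union \<open>L\<close> of finitely many small pieces, \<open>f\<close> is
  replaced by a function \<open>v\<close> that is constant on each piece. Uniform continuity makes
  the change small, and Tietze's theorem extends it to \<open>S\<close>.\<close>

lemma tame_functions_dense:
  fixes S :: "'a::euclidean_space set"
  assumes K: "compact K" "K \<subseteq> S" and e: "0 < e" "e < 1"
    and W: "openin (compact_open_topology S) W" "W \<noteq> {}"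
  shows "W \<inter> tame_functions S K e \<noteq> {}"
proof -
  obtain f where f: "f \<in> W" using W by blast
  then have "f \<in> continuous_functions S" using openin_subset[OF W(1)] by auto
  then have contf: "continuous_on S f" by (simp add: continuous_functions_def)
  obtain \<eta> where \<eta>: "0 < \<eta>"
    "\<And>g. g \<in> continuous_functions S \<Longrightarrow> (\<And>x. x \<in> S \<Longrightarrow> \<bar>g x - f x\<bar> < \<eta>) \<Longrightarrow> g \<in> W"
    using openin_compact_open_nbhd[OF W(1) f] by blast
  have "uniformly_continuous_on K f"
    using K contf by (meson compact_uniformly_continuous continuous_on_subset)
  then obtain \<sigma> where \<sigma>: "0 < \<sigma>"
    "\<And>x y. x \<in> K \<Longrightarrow> y \<in> K \<Longrightarrow> dist x y < \<sigma> \<Longrightarrow> dist (f x) (f y) < \<eta> / 2"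
    unfolding uniformly_continuous_on_def using half_gt_zero[OF \<eta>(1)] by metis
  obtain N :: nat and c C where c: "\<And>i. i < N \<Longrightarrow> c i \<in> K" and C: "\<And>i. closed (C i)"
    "\<And>i. C i \<subseteq> cball (c i) (\<sigma>/2)" "disjoint_family C"
    and thin: "thinly_covered (real DIM('a) - 1) e (K - (\<Union>i<N. C i))" "porous_below e (K - (\<Union>i<N. C i))"
    using porous_complement_of_cells[OF K(1) e half_gt_zero[OF \<sigma>(1)]] by blast
  define L where "L = (\<Union>i<N. K \<inter> C i)"
  have L: "compact L" "L \<subseteq> K" "K - L = K - (\<Union>i<N. C i)"
    unfolding L_def using K C by (auto intro!: compact_UN compact_Int_closed)
  define v where "v x = f (c (THE i. x \<in> C i))" for x
  have v: "v x = f (c i)" if "x \<in> C i" for x i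
  proof -
    have "(THE i. x \<in> C i) = i"
      using that C(3) by (intro the_equality) (auto simp: disjoint_family_on_def)
    then show ?thesis by (simp add: v_def)
  qed
  have "continuous_on (K \<inter> C i) v" for i
    by (rule continuous_on_eq[OF continuous_on_const[of _ "f (c i)"]]) (simp add: v[of _ i])
  then have "continuous_on L v"
    unfolding L_def using K C by (intro continuous_on_closed_Union) (auto intro: closed_Int compact_imp_closed)
  then have "continuous_on L (\<lambda>x. v x - f x)"
    using contf L(2) K(2) by (intro continuous_on_diff) (auto intro: continuous_on_subset)
  moreover have "closedin (top_of_set S) L"
    using L K by (meson closed_subset compact_imp_closed order_trans)
  moreover have "norm (v x - f x) \<le> \<eta> / 2" if "x \<in> L" for x
  proof -
    obtain i where i: "i < N" "x \<in> K" "x \<in> C i" using \<open>x \<in> L\<close> by (auto simp: L_def)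
    then have "dist (c i) x \<le> \<sigma> / 2" using C(2)[of i] by auto
    then have "dist (f (c i)) (f x) < \<eta> / 2" using \<sigma> i c by simp
    then show ?thesis using v[OF i(3)] by (simp add: dist_norm)
  qed
  \<comment> \<open>Extending the difference \<open>v - f\<close> instead of \<open>v\<close>
    preserves the bound \<open>\<eta> / 2\<close>, so that \<open>f + h\<close> stays close to
    \<open>f\<close> on all of \<open>S\<close>, not only on \<open>L\<close>.\<close>
  ultimately obtain h where h: "continuous_on S h" "\<And>x. x \<in> L \<Longrightarrow> h x = v x - f x"
      "\<And>x. x \<in> S \<Longrightarrow> norm (h x) \<le> \<eta> / 2"
    using Tietze[of L "\<lambda>x. v x - f x" S "\<eta> / 2"] \<eta>(1) by (auto simp: less_imp_le)
  define g where "g = restrict (\<lambda>x. f x + h x) S"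
  have "continuous_on S (\<lambda>x. f x + h x)" using contf h(1) by (rule continuous_on_add)
  then have "continuous_on S g" by (rule continuous_on_eq) (simp add: g_def)
  then have g: "g \<in> continuous_functions S" by (simp add: continuous_functions_def g_def)
  have "\<bar>g x - f x\<bar> < \<eta>" if "x \<in> S" for x
    using h(3)[OF that] that \<eta>(1) by (simp add: g_def)
  then have "g \<in> W" using \<eta>(2)[OF g] by blast
  have "g x = v x" if "x \<in> L" for x using that h(2) L K by (auto simp: g_def)
  then have gL: "g ` L \<subseteq> (\<lambda>i. f (c i)) ` {..<N}" using v by (force simp: L_def)
  obtain U where U: "open U" "(\<lambda>i. f (c i)) ` {..<N} \<subseteq> U" "thinly_covered 0 e U"
    using thinly_covered_nbhd_finite[of "(\<lambda>i. f (c i)) ` {..<N}" e] e(1) by blast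
  have "g ` L \<subseteq> U" using gL U(2) by (rule order_trans)
  then have "g \<in> tame_functions S K e"
    unfolding tame_functions_def using g L(1,2) U(1,3) thin[folded L(3)]
    by (intro CollectI conjI exI[of _ L] exI[of _ U])
  with \<open>g \<in> W\<close> show ?thesis by blast
qed

section \<open>Comeager intersections and compact exhaustion\<close>

lemma comeager_in_INT:
  fixes G :: "nat \<Rightarrow> 'a set"
  assumes "\<And>n. openin X (G n)" "\<And>n W. openin X W \<Longrightarrow> W \<noteq> {} \<Longrightarrow> W \<inter> G n \<noteq> {}"
  shows "comeager_in X (\<Inter>n. G n)"
proof -
  have "nowhere_dense_in X (topspace X - G n)" for n
  proof -
    have "X closure_of (topspace X - G n) = topspace X - G n"
      using assms(1) by (intro closure_of_closedin) auto
    moreover have "X interior_of (topspace X - G n) = {}"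
      using assms(2)[OF openin_interior_of, of "topspace X - G n" n] interior_of_subset[of X "topspace X - G n"]
      by blast
    ultimately show ?thesis by (simp add: nowhere_dense_in_def)
  qed
  moreover have "topspace X - (\<Inter>n. G n) = (\<Union>n. topspace X - G n)" by blast
  moreover have "(\<Inter>n. G n) \<subseteq> topspace X" using assms(1) openin_subset by blast
  ultimately show ?thesis unfolding comeager_in_def meager_in_def by metis
qed

text \<open>A locally compact set is the intersection of a closed and an open set; a compact
  exhaustion of the open set is intersected with the closed one.\<close>

lemma locally_compact_exhaustion:
  fixes S :: "'a::euclidean_space set"
  assumes "locally compact S"
  obtains K :: "nat \<Rightarrow> 'a set" where "\<And>n. compact (K n)" "incseq K" "(\<Union>n. K n) = S"
proof -
  obtain U V where UV: "closed U" "open V" "S = U \<inter> V"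
    using assms by (auto simp: locally_compact_closed_Int_open)
  obtain C where C: "\<And>n. compact (C n)" "\<And>n. C n \<subseteq> interior (C (Suc n))" "\<Union>(range C) = V"
    using open_Union_compact_subsets[OF UV(2)] by metis
  have "incseq C" using C(2) interior_subset by (intro incseq_SucI) blast
  then have "incseq (\<lambda>n. U \<inter> C n)" by (fastforce simp: incseq_def)
  moreover have "compact (U \<inter> C n)" for n using UV(1) C(1) by (rule closed_Int_compact)
  moreover have "(\<Union>n. U \<inter> C n) = S" using C(3) UV(3) by blast
  ultimately show thesis by (intro that[of "\<lambda>n. U \<inter> C n"])
qed

section \<open>Porosity and dimensions from the one-scale properties\<close>

text \<open>A hole misses \<open>x\<close>, so its radius is less than the distance from its centre
  to \<open>x\<close>. Hence porosity at points of \<open>E\<close> is at most 1, and strong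
  porosity amounts to the lower bound.\<close>

lemma pore_size_le:
  assumes "x \<in> E"
  shows "pore_size E x r \<le> ennreal r"
  unfolding pore_size_def
proof (rule Sup_least, clarify)
  fix s y assume "0 < s" "y \<in> cball x r" "cball y s \<inter> E = {}"
  then have "x \<notin> cball y s" "y \<in> cball x r" using assms by blast+
  then have "s < dist y x" "dist x y \<le> r" by auto
  then show "ennreal s \<le> ennreal r" by (intro ennreal_leI) (simp add: dist_commute)
qed

lemma strongly_porousI:
  assumes "\<And>e. 0 < e \<Longrightarrow> \<exists>e'. 0 < e' \<and> e' < e \<and> porous_below e' E"
  shows "strongly_porous E"
  unfolding strongly_porous_def
proof
  fix x assume x: "x \<in> E"
  have "pore_size E x r / ennreal r \<le> 1" if "0 < r" for r
    using divide_right_mono_ennreal[OF pore_size_le[OF x, of r], of "ennreal r"] that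
    by (simp add: ennreal_divide_self)
  then have "porosity E x \<le> 1"
    unfolding porosity_def by (intro Limsup_bounded) (auto simp: eventually_at_filter)
  moreover have "1 \<le> porosity E x"
    unfolding porosity_def
  proof (rule Limsup_greatest)
    fix P :: "real \<Rightarrow> bool" assume "eventually P (at_right 0)"
    then obtain b where b: "0 < b" "\<And>r. 0 < r \<Longrightarrow> r < b \<Longrightarrow> P r"
      by (auto simp: eventually_at_right_field)
    show "1 \<le> (SUP r\<in>Collect P. pore_size E x r / ennreal r)"
    proof (rule dense_le)
      fix z :: ennreal assume z: "z < 1"
      then obtain q where q: "z = ennreal q" "0 \<le> q" "q < 1"
        by (cases z) (auto simp: ennreal_less_iff simp flip: ennreal_1)
      \<comment> \<open>The bound \<open>b\<close> forces \<open>P r\<close> for the radius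
        \<open>r < e\<close>, and \<open>1 - q\<close> makes the relative size \<open>1 - e\<close>
        of the hole exceed \<open>q\<close>.\<close>
      obtain e where e: "0 < e" "e < min b (1 - q)" "porous_below e E"
        using assms[of "min b (1 - q)"] b q by auto
      obtain r y where r: "0 < r" "r < e" "y \<in> cball x r" "cball y ((1 - e) * r) \<inter> E = {}"
        using e(3) x unfolding porous_below_def by blast
      have "0 < (1 - e) * r" using e q r by simp
      then have "ennreal ((1 - e) * r) \<le> pore_size E x r"
        unfolding pore_size_def using r by (intro Sup_upper) blast
      then have "ennreal ((1 - e) * r) / ennreal r \<le> pore_size E x r / ennreal r"
        by (rule divide_right_mono_ennreal)
      moreover have "ennreal ((1 - e) * r) / ennreal r = ennreal (1 - e)"
        using e q r by (simp add: divide_ennreal)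
      moreover have "z \<le> ennreal (1 - e)" using e q by (auto intro: ennreal_leI)
      ultimately have "z \<le> pore_size E x r / ennreal r" by simp
      also have "\<dots> \<le> (SUP r\<in>Collect P. pore_size E x r / ennreal r)"
        using b r e by (intro SUP_upper) simp
      finally show "z \<le> (SUP r\<in>Collect P. pore_size E x r / ennreal r)" .
    qed
  qed
  ultimately show "porosity E x = 1" by (rule antisym)
qed

lemma ennreal_eq_0_if_le_pos:
  fixes x :: ennreal
  assumes "\<And>e::real. 0 < e \<Longrightarrow> x \<le> ennreal e"
  shows "x = 0"
  using ennreal_le_epsilon[of 0 x] assms by simp

lemma packing_premeasure_eq_0:
  assumes "p < s" and thin: "\<And>e. 0 < e \<Longrightarrow> \<exists>e'. 0 < e' \<and> e' < e \<and> thinly_covered p e' E"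
  shows "packing_premeasure s E = 0"
proof (rule ennreal_eq_0_if_le_pos)
  fix \<epsilon> :: real assume \<epsilon>: "0 < \<epsilon>"
  show "packing_premeasure s E \<le> ennreal \<epsilon>"
    unfolding packing_premeasure_def
  proof (rule Liminf_least)
    fix P :: "real \<Rightarrow> bool" assume "eventually P (at_right 0)"
    then obtain b where b: "0 < b" "\<And>r. 0 < r \<Longrightarrow> r < b \<Longrightarrow> P r"
      by (auto simp: eventually_at_right_field)
    \<comment> \<open>Below \<open>b\<close> the scale satisfies \<open>P\<close>; below 1 powers
      decrease in the exponent; \<open>s - p\<close> absorbs the loss \<open>e\<close> in the
      exponent; \<open>\<epsilon>\<close> bounds the covering sum.\<close>
    define m where "m = min (min b 1) (min (s - p) \<epsilon>)"
    have "0 < m" using b \<epsilon> assms(1) by (simp add: m_def)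
    then obtain e where e: "0 < e" "e < m" "thinly_covered p e E" using thin by blast
    then obtain \<delta> \<U> where \<U>: "0 < \<delta>" "\<delta> < e" "finite \<U>" "\<And>U. U \<in> \<U> \<Longrightarrow> bounded U \<and> diameter U \<le> \<delta>"
        "E \<subseteq> \<Union>\<U>" "real (card \<U>) * \<delta> powr (p + e) \<le> e"
      unfolding thinly_covered_def by blast
    have "covering_number \<delta> E \<le> of_nat (card \<U>)"
      unfolding covering_number_def using \<U> by (intro Inf_lower) blast
    then have "covering_number \<delta> E * ennreal (\<delta> powr s) \<le> ennreal (real (card \<U>) * \<delta> powr s)"
      by (simp add: ennreal_mult mult_right_mono flip: ennreal_of_nat_eq_real_of_nat)
    also have "\<dots> \<le> ennreal \<epsilon>"
    proof (rule ennreal_leI)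
      have "\<delta> powr s \<le> \<delta> powr (p + e)"
        using \<U> e by (intro powr_mono') (auto simp: m_def)
      then have "real (card \<U>) * \<delta> powr s \<le> real (card \<U>) * \<delta> powr (p + e)"
        by (rule mult_left_mono) simp
      then show "real (card \<U>) * \<delta> powr s \<le> \<epsilon>" using \<U>(6) e by (simp add: m_def)
    qed
    finally have "covering_number \<delta> E * ennreal (\<delta> powr s) \<le> ennreal \<epsilon>" .
    moreover have "P \<delta>" using b \<U> e by (simp add: m_def)
    ultimately show "(INF \<delta>\<in>Collect P. covering_number \<delta> E * ennreal (\<delta> powr s)) \<le> ennreal \<epsilon>"
      by (intro INF_lower2[of \<delta>]) auto
  qed
qed

text \<open>The sets \<open>A m\<close> themselves form an admissible cover, and each has premeasure
  zero for every exponent above \<open>p\<close>.\<close>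

lemma lower_packing_dim_le:
  fixes A :: "nat \<Rightarrow> 'a::metric_space set"
  assumes "\<And>m e. 0 < e \<Longrightarrow> \<exists>e'. 0 < e' \<and> e' < e \<and> thinly_covered p e' (A m)"
  shows "lower_packing_dim (\<Union>m. A m) \<le> ennreal p"
  unfolding lower_packing_dim_def
proof (rule Sup_least, clarify)
  fix s :: real assume s: "0 < s" "0 < lower_packing_measure s (\<Union>m. A m)"
  show "ennreal s \<le> ennreal p"
  proof (rule ccontr)
    assume "\<not> ennreal s \<le> ennreal p"
    then have "p < s" by (meson ennreal_leI not_le)
    then have "packing_premeasure s (A m) = 0" for m
      using assms by (intro packing_premeasure_eq_0)
    then have "(\<Sum>m. packing_premeasure s (A m)) = 0" by simp
    moreover have "lower_packing_measure s (\<Union>m. A m) \<le> (\<Sum>m. packing_premeasure s (A m))"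
      unfolding lower_packing_measure_def by (intro Inf_lower) blast
    ultimately show False using s(2) by simp
  qed
qed

lemma thinly_covered_sequence:
  assumes "thinly_covered 0 e E" "e < 1" "e \<le> s"
  obtains V :: "nat \<Rightarrow> 'a::metric_space set" where "\<And>j. bounded (V j) \<and> diameter (V j) \<le> e"
    "E \<subseteq> (\<Union>j. V j)" "(\<Sum>j. ennreal (diameter (V j) powr s)) \<le> ennreal e"
proof -
  obtain \<delta> \<U> where \<U>: "0 < \<delta>" "\<delta> < e" "finite \<U>" "\<And>U. U \<in> \<U> \<Longrightarrow> bounded U \<and> diameter U \<le> \<delta>"
      "E \<subseteq> \<Union>\<U>" "real (card \<U>) * \<delta> powr e \<le> e"
    using assms(1) unfolding thinly_covered_def by auto
  obtain Us where Us: "set Us = \<U>" "distinct Us" using finite_distinct_list[OF \<U>(3)] by blast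
  \<comment> \<open>Padding with empty sets costs nothing, because their diameter is 0 and
    \<open>0 powr s\<close> is 0.\<close>
  define V where "V j = (if j < length Us then Us ! j else {})" for j
  have V: "bounded (V j) \<and> diameter (V j) \<le> \<delta>" for j
    using \<U>(1,4) Us(1) by (auto simp: V_def)
  have "diameter (V j) powr s \<le> \<delta> powr e" for j
  proof -
    have "diameter (V j) powr s \<le> \<delta> powr s"
      using V[of j] \<U> assms by (intro powr_mono2) (auto intro: diameter_ge_0)
    also have "\<dots> \<le> \<delta> powr e" using \<U> assms by (intro powr_mono') auto
    finally show ?thesis .
  qed
  note le = this
  have "(\<Sum>j. ennreal (diameter (V j) powr s)) = (\<Sum>j<length Us. ennreal (diameter (V j) powr s))"
    by (intro suminf_finite) (auto simp: V_def)
  also have "\<dots> \<le> (\<Sum>j<length Us. ennreal (\<delta> powr e))"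
    by (intro sum_mono ennreal_leI le)
  also have "\<dots> = ennreal (real (card \<U>) * \<delta> powr e)"
    using distinct_card[OF Us(2)] Us(1) by (simp add: ennreal_mult ennreal_of_nat_eq_real_of_nat)
  also have "\<dots> \<le> ennreal e" using \<U>(6) by (rule ennreal_leI)
  finally have "(\<Sum>j. ennreal (diameter (V j) powr s)) \<le> ennreal e" .
  moreover have "E \<subseteq> (\<Union>j. V j)"
  proof
    fix x assume "x \<in> E"
    then obtain U where "U \<in> \<U>" "x \<in> U" using \<U>(5) by blast
    then obtain j where "j < length Us" "Us ! j = U" using Us(1) by (metis in_set_conv_nth)
    with \<open>x \<in> U\<close> show "x \<in> (\<Union>j. V j)" by (auto simp: V_def)
  qed
  moreover have "bounded (V j) \<and> diameter (V j) \<le> e" for j using V[of j] \<U>(2) by auto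
  ultimately show thesis using that by blast
qed

text \<open>A Borel-Cantelli argument: the covers of all \<open>U n\<close> with
  \<open>n \<ge> m\<close> together cover \<open>E\<close>, and their sums add up to at most the
  geometric tail \<open>(1/2) ^ m\<close>.\<close>

lemma hausdorff_dim_limsup_eq_0:
  fixes U :: "nat \<Rightarrow> 'a::metric_space set"
  assumes thin: "\<And>n. thinly_covered 0 ((1/2) ^ Suc n) (U n)"
    and E: "\<And>m. E \<subseteq> (\<Union>n\<in>{m..}. U n)"
  shows "hausdorff_dim E = 0"
proof -
  have prem: "hausdorff_premeasure s \<delta> E \<le> ennreal \<epsilon>" if pos: "0 < s" "0 < \<delta>" "0 < \<epsilon>" for s \<delta> \<epsilon>
  proof -
    \<comment> \<open>Being below \<open>s\<close> allows the sums to be taken with exponent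
      \<open>s\<close>, being below \<open>\<delta>\<close> bounds the diameters, and being below
      \<open>\<epsilon>\<close> bounds the total.\<close>
    obtain m where m: "(1/2) ^ m < min s (min \<delta> \<epsilon>)"
      using real_arch_pow_inv[of "min s (min \<delta> \<epsilon>)" "1/2"] pos by auto
    have small: "(1/2) ^ Suc (m + n) \<le> min s (min \<delta> \<epsilon>)" for n :: nat
    proof -
      have "(1/2 :: real) ^ Suc (m + n) \<le> (1/2) ^ m" by (intro power_decreasing) auto
      with m show ?thesis by linarith
    qed
    have "\<exists>V :: nat \<Rightarrow> 'a set. (\<forall>j. bounded (V j) \<and> diameter (V j) \<le> (1/2) ^ Suc (m + n)) \<and>
        U (m + n) \<subseteq> (\<Union>j. V j) \<and> (\<Sum>j. ennreal (diameter (V j) powr s)) \<le> ennreal ((1/2) ^ Suc (m + n))" for n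
      by (rule thinly_covered_sequence[OF thin[of "m + n"], of s])
        (use small[of n] power_Suc_less_one[of "1/2::real" "m + n"] in auto)
    then obtain V :: "nat \<Rightarrow> nat \<Rightarrow> 'a set" where
      V: "\<And>n j. bounded (V n j)" "\<And>n j. diameter (V n j) \<le> (1/2) ^ Suc (m + n)"
        "\<And>n. U (m + n) \<subseteq> (\<Union>j. V n j)"
        "\<And>n. (\<Sum>j. ennreal (diameter (V n j) powr s)) \<le> ennreal ((1/2) ^ Suc (m + n))"
      by metis
    \<comment> \<open>Enumerating pairs merges the covers into the single sequence that the
      premeasure asks for.\<close>
    define W where "W k = (case prod_decode k of (n, j) \<Rightarrow> V n j)" for k
    let ?f = "\<lambda>(n, j). ennreal (diameter (V n j) powr s)"
    have "ennreal (diameter (W k) powr s) = ?f (prod_decode k)" for k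
      by (simp add: W_def split: prod.split)
    moreover have "(\<Sum>k. ?f (prod_decode k)) = (\<Sum>n. \<Sum>j. ennreal (diameter (V n j) powr s))"
      by (rule suminf_ennreal_2dimen) simp
    ultimately have "(\<Sum>k. ennreal (diameter (W k) powr s)) = (\<Sum>n. \<Sum>j. ennreal (diameter (V n j) powr s))"
      by (simp only:)
    also have "\<dots> \<le> (\<Sum>n. ennreal ((1/2) ^ Suc (m + n)))"
      by (intro suminf_le V) auto
    also have "\<dots> = ennreal ((1/2) ^ m)"
    proof (rule suminf_ennreal_eq)
      have "(\<lambda>n. (1/2) ^ m * (1/2) ^ Suc n) sums ((1/2 :: real) ^ m * 1)"
        by (intro sums_mult power_half_series)
      then show "(\<lambda>n. (1/2 :: real) ^ Suc (m + n)) sums (1/2) ^ m"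
        by (simp add: power_add mult_ac)
    qed auto
    also have "\<dots> \<le> ennreal \<epsilon>" using m by (intro ennreal_leI) simp
    finally have sum: "(\<Sum>k. ennreal (diameter (W k) powr s)) \<le> ennreal \<epsilon>" .
    have W: "bounded (W k) \<and> diameter (W k) \<le> \<delta>" for k
    proof -
      obtain n j where "prod_decode k = (n, j)" by fastforce
      then show ?thesis using V(1)[of n j] V(2)[of n j] small[of n] by (simp add: W_def)
    qed
    have cov: "E \<subseteq> (\<Union>k. W k)"
    proof
      fix x assume "x \<in> E"
      then obtain n where n: "m \<le> n" "x \<in> U n" using E[of m] by auto
      then have "x \<in> U (m + (n - m))" by simp
      then obtain j where "x \<in> V (n - m) j" using V(3)[of "n - m"] by blast
      then have "x \<in> W (prod_encode (n - m, j))" by (simp add: W_def)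
      then show "x \<in> (\<Union>k. W k)" by blast
    qed
    have "hausdorff_premeasure s \<delta> E \<le> (\<Sum>k. ennreal (diameter (W k) powr s))"
      unfolding hausdorff_premeasure_def using W cov by (intro Inf_lower) blast
    with sum show ?thesis by (rule order_trans[rotated])
  qed
  have "hausdorff_measure s E = 0" if "0 < s" for s
    unfolding hausdorff_measure_def
    using prem[OF that, THEN ennreal_eq_0_if_le_pos] by (simp add: SUP_eq_const)
  then have "hausdorff_dim E \<le> ennreal s" if "0 < s" for s
    unfolding hausdorff_dim_def using that by (intro Inf_lower) blast
  then show ?thesis by (rule ennreal_eq_0_if_le_pos)
qed

section \<open>The set \<open>A\<close> for a typical function\<close>

theorem theorem1p2:
  fixes \<Omega> :: "(real ^ 'd) set"
  assumes "locally compact \<Omega>"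
  shows "\<exists>\<F>. comeager_in (compact_open_topology \<Omega>) \<F> \<and>
    (\<forall>f \<in> \<F>. \<exists>A \<subseteq> \<Omega>.
       sigma_strongly_porous A \<and>
       lower_packing_dim A \<le> ennreal (real CARD('d) - 1) \<and>
       hausdorff_dim {y. \<not> {x \<in> \<Omega>. f x = y} \<subseteq> A} = 0)"
proof -
  obtain K :: "nat \<Rightarrow> (real ^ 'd) set" where
    K: "\<And>n. compact (K n)" "incseq K" "(\<Union>n. K n) = \<Omega>"
    using locally_compact_exhaustion[OF assms] by metis
  then have K_sub: "K n \<subseteq> \<Omega>" for n by blast
  \<comment> \<open>The exponent \<open>Suc n\<close> keeps \<open>e 0\<close> below 1, as the
    relative hole size \<open>1 - e n\<close> must be positive.\<close>
  define e :: "nat \<Rightarrow> real" where "e n = (1/2) ^ Suc n" for n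
  have e: "0 < e n" "e n < 1" for n
    unfolding e_def by (simp, rule power_Suc_less_one) auto
  have e_small: "\<exists>n\<ge>m. e n < \<epsilon>" if \<epsilon>: "0 < \<epsilon>" for m \<epsilon>
  proof -
    obtain n where n: "(1/2) ^ n < \<epsilon>" using real_arch_pow_inv[OF \<epsilon>, of "1/2"] by auto
    have "e (max m n) \<le> (1/2) ^ n" unfolding e_def by (intro power_decreasing) auto
    with n show ?thesis by (intro exI[of _ "max m n"]) simp
  qed
  define \<F> where "\<F> = (\<Inter>n. tame_functions \<Omega> (K n) (e n))"
  have "comeager_in (compact_open_topology \<Omega>) \<F>"
    unfolding \<F>_def
    by (intro comeager_in_INT openin_tame_functions tame_functions_dense K K_sub e)
  moreover have "\<exists>A \<subseteq> \<Omega>. sigma_strongly_porous A \<and>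
      lower_packing_dim A \<le> ennreal (real CARD('d) - 1) \<and>
      hausdorff_dim {y. \<not> {x \<in> \<Omega>. f x = y} \<subseteq> A} = 0" if "f \<in> \<F>" for f
  proof -
    have "\<exists>L U. L \<subseteq> K n \<and> f ` L \<subseteq> U \<and> thinly_covered (real CARD('d) - 1) (e n) (K n - L) \<and>
        porous_below (e n) (K n - L) \<and> thinly_covered 0 (e n) U" for n
    proof -
      have "f \<in> tame_functions \<Omega> (K n) (e n)" using that by (simp add: \<F>_def)
      then show ?thesis unfolding tame_functions_def by (simp only: mem_Collect_eq DIM_cart DIM_real mult_1_right) blast
    qed
    then obtain L U where LU: "\<And>n. f ` L n \<subseteq> U n"
      "\<And>n. thinly_covered (real CARD('d) - 1) (e n) (K n - L n)"
      "\<And>n. porous_below (e n) (K n - L n)" "\<And>n. thinly_covered 0 (e n) (U n)"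
      by metis
    \<comment> \<open>Each \<open>A m\<close> lies in \<open>K n - L n\<close> for all
      \<open>n \<ge> m\<close>, so it inherits both one-scale properties for arbitrarily small
      \<open>e n\<close>. The union over \<open>m\<close> is the lower limit of these sets.\<close>
    define A where "A m = (\<Inter>n\<in>{m..}. K n - L n)" for m
    have A_sub: "A m \<subseteq> K n - L n" if "m \<le> n" for m n using that by (auto simp: A_def)
    have A_fine: "\<exists>e'. 0 < e' \<and> e' < \<epsilon> \<and> thinly_covered (real CARD('d) - 1) e' (A m) \<and> porous_below e' (A m)"
      if \<epsilon>: "0 < \<epsilon>" for \<epsilon> m
    proof -
      obtain n where n: "m \<le> n" "e n < \<epsilon>" using e_small[OF \<epsilon>] by blast
      show ?thesis
        using n(2) e(1) thinly_covered_subset[OF LU(2) A_sub[OF n(1)]]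
          porous_below_subset[OF LU(3) A_sub[OF n(1)]]
        by (intro exI[of _ "e n"] conjI)
    qed
    have "sigma_strongly_porous (\<Union>m. A m)"
      unfolding sigma_strongly_porous_def
      using A_fine by (intro exI[of _ A] conjI allI strongly_porousI) (fast, rule refl)
    moreover have "lower_packing_dim (\<Union>m. A m) \<le> ennreal (real CARD('d) - 1)"
      using A_fine by (intro lower_packing_dim_le) fast
    moreover have "(\<Union>m. A m) \<subseteq> \<Omega>" using A_sub K_sub by blast
    moreover have "hausdorff_dim {y. \<not> {x \<in> \<Omega>. f x = y} \<subseteq> (\<Union>m. A m)} = 0"
    proof (rule hausdorff_dim_limsup_eq_0)
      show "thinly_covered 0 ((1/2) ^ Suc n) (U n)" for n using LU(4)[of n] by (simp only: e_def)
      show "{y. \<not> {x \<in> \<Omega>. f x = y} \<subseteq> (\<Union>m. A m)} \<subseteq> (\<Union>n\<in>{m..}. U n)" for m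
      proof
        fix y assume "y \<in> {y. \<not> {x \<in> \<Omega>. f x = y} \<subseteq> (\<Union>m. A m)}"
        then obtain x where x: "x \<in> \<Omega>" "f x = y" "\<And>m. x \<notin> A m" by blast
        then obtain j where "x \<in> K j" using K(3) by blast
        \<comment> \<open>From index \<open>j\<close> on, the sets \<open>K n\<close> contain
          \<open>x\<close>, so missing \<open>K n - L n\<close> means lying in \<open>L n\<close>;
          taking \<open>n \<ge> m\<close> as well puts \<open>y\<close> into the required tail of
          the \<open>U n\<close>.\<close>
        moreover obtain n where n: "max m j \<le> n" "x \<notin> K n - L n"
          using x(3)[of "max m j"] by (auto simp: A_def)
        ultimately have "x \<in> L n" using incseqD[OF K(2), of j n] by auto
        then have "y \<in> U n" using LU(1)[of n] x(2) by blast
        with n(1) show "y \<in> (\<Union>n\<in>{m..}. U n)" by auto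
      qed
    qed
    ultimately show ?thesis by blast
  qed
  ultimately show ?thesis by blast
qed

end
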